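(* Let $p$ and $q$ be two complex numbers such that $|p|<|q|<1$. Then $$\sum_{n=-\infty}^\infty (bq^n,aq^{-n};p)_\infty\, z^n q^{n(n-1)/2}=\frac{(-z,-q/z;q)_\infty}{\ln\frac{1}{q}}\int_0^\infty\frac{\left(bt/z,az/t;p\right)_\infty}{\left(-t,-q/t;q\right)_\infty}\frac{dt}{t}.$$
   Context: Here $a,b$ are complex parameters and $z$ is a nonzero complex number. For complex $c$ and $|r|<1$, $(c;r)_\infty=\prod_{k=0}^\infty(1-cr^k)$, and $(c_1,\dots,c_m;r)_\infty=\prod_{j=1}^m(c_j;r)_\infty$.
   Formalization: For q not in (0,1) the integral over the positive real axis can diverge (q=-1/2 has a pole at t=2) or give a wrong value, so the integral from 0 to infinity is taken along t=q^(-s), s real, with the principal ln(1/q); for 0<q<1 this is the usual integral. *)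

theory Defs
  imports "HOL-Analysis.Analysis"
begin

definition qpoch :: "complex \<Rightarrow> complex \<Rightarrow> complex"
  where "qpoch c r = (\<Prod>k. 1 - c * r ^ k)"

lemma convergent_prod_qpoch:
  fixes c r :: complex
  assumes "norm r < 1"
  shows "convergent_prod (\<lambda>k. 1 - c * r ^ k)"
proof -
  have "summable (\<lambda>k. norm c * norm r ^ k)"
    using assms by (intro summable_mult summable_geometric) auto
  moreover have "norm ((1 - c * r ^ k) - 1) = norm c * norm r ^ k" for k
    by (simp add: norm_mult norm_power)
  ultimately have "summable (\<lambda>k. norm ((1 - c * r ^ k) - 1))"
    by (simp only:)
  then show ?thesis
    by (intro abs_convergent_prod_imp_convergent_prod summable_imp_abs_convergent_prod)
qed

(* The path t = q^(-s), with q^(-s) = exp (s * Ln (1/q)) and the principal logarithm.  It runs from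
   0 (s -> -infinity) to infinity (s -> +infinity) when 0 < |q| < 1.  For 0 < q < 1 it is the
   positive real axis, for other q a logarithmic spiral, which never meets the zeros -q^n (n an
   integer) of the theta function (-t, -q/t; q).  The positive real axis itself may contain such
   zeros when q is not a positive real. *)
definition qpath :: "complex \<Rightarrow> real \<Rightarrow> complex"
  where "qpath q s = exp (of_real s * Ln (1 / q))"

lemma qpath_has_vector_derivative:
  "(qpath q has_vector_derivative Ln (1 / q) * qpath q s) (at s within S)"
  unfolding qpath_def
  by (rule has_vector_derivative_real_field)
     (auto intro!: derivative_eq_intros)

definition qpath_integrand :: "complex \<Rightarrow> (complex \<Rightarrow> complex) \<Rightarrow> real \<Rightarrow> complex"
  where "qpath_integrand q f s = f (qpath q s) * vector_derivative (qpath q) (at s)"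

definition qpath_integrable :: "complex \<Rightarrow> (complex \<Rightarrow> complex) \<Rightarrow> bool"
  where "qpath_integrable q f \<longleftrightarrow> qpath_integrand q f absolutely_integrable_on UNIV"

(* The contour integral of f(t) dt from 0 to infinity along t = q^(-s). *)
definition qpath_integral :: "complex \<Rightarrow> (complex \<Rightarrow> complex) \<Rightarrow> complex"
  where "qpath_integral q f = integral UNIV (qpath_integrand q f)"

lemma qpath_integral_of_real:
  assumes "0 < r" "r < 1"
  shows "qpath_integrable (of_real r) f \<longleftrightarrow>
           (\<lambda>t::real. f (of_real t)) absolutely_integrable_on {0<..}" (is ?A)
    and "qpath_integrable (of_real r) f \<Longrightarrow>
           qpath_integral (of_real r) f = integral {0<..} (\<lambda>t::real. f (of_real t))"
proof -
  define c where "c = ln (1 / r)"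
  have c: "c > 0" using assms by (simp add: c_def)
  define g where "g = (\<lambda>s. exp (s * c))"
  have Ln: "Ln (1 / complex_of_real r) = of_real c"
    using assms Ln_of_real[of "1 / r"] by (simp add: c_def)
  have path: "qpath (of_real r) s = of_real (g s)" for s
    by (simp add: qpath_def Ln g_def exp_of_real flip: of_real_mult)
  have integrand: "qpath_integrand (of_real r) f = (\<lambda>s. \<bar>c * g s\<bar> *\<^sub>R f (of_real (g s)))"
    using c
    by (auto simp: qpath_integrand_def vector_derivative_at[OF qpath_has_vector_derivative] Ln path
        g_def abs_mult scaleR_conv_of_real)
  have deriv: "(g has_field_derivative c * g s) (at s within UNIV)" for s
    unfolding g_def by (auto intro!: derivative_eq_intros)
  have inj: "inj_on g UNIV"
    using c by (auto simp: inj_on_def g_def)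
  have range: "range g = {0<..}"
  proof safe
    fix t :: real assume "t > 0"
    then have "t = g (ln t / c)" using c by (simp add: g_def)
    then show "t \<in> range g" by blast
  qed (simp add: g_def)
  have iff: "(qpath_integrable (of_real r) f \<and> qpath_integral (of_real r) f = I) \<longleftrightarrow>
        ((\<lambda>t::real. f (of_real t)) absolutely_integrable_on {0<..} \<and>
         integral {0<..} (\<lambda>t::real. f (of_real t)) = I)" for I
    unfolding qpath_integrable_def qpath_integral_def integrand range[symmetric]
    by (rule has_absolute_integral_change_of_variables_real) (use deriv inj in auto)
  show ?A
    using iff by blast
  show "qpath_integral (of_real r) f = integral {0<..} (\<lambda>t::real. f (of_real t))"
    if "qpath_integrable (of_real r) f"
    using iff that by blast
qed

end

theory Submission
  imports Defs
begin

text \<open>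
  Euler's expansion writes \<open>(b q^n, a q^{-n}; p)\<close> as a double power series in \<open>q^n\<close> and \<open>q^{-n}\<close>.
  Completing the square in the exponent of \<open>q\<close> shows that, with \<open>b/z\<close> and \<open>a z\<close> held fixed, the
  bilateral sum is a constant multiple of the theta function \<open>(-z, -q/z; q)\<close>; here \<open>|p| < |q|\<close> makes
  the double series converge.  Hence the constant is the value at any other point \<open>t\<close> of the same
  sum divided by theta.  By quasi-periodicity of theta the integrand at \<open>q^n t\<close> is the \<open>n\<close>-th term
  at \<open>t\<close> of this quotient, so folding the integral into one period \<open>0 \<le> s \<le> 1\<close> of \<open>t = q^{-s}\<close>
  gives the constant times \<open>Ln (1/q)\<close>.
\<close>

section \<open>Tools for absolute summability\<close>

text \<open>The ratio test in recurrence form: vanishing terms, as for \<open>x = 0\<close> or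
  \<open>p = 0\<close> in the series below, then cause no division by zero.\<close>

lemma summable_norm_ratio_limit:
  fixes f r :: "nat \<Rightarrow> complex"
  assumes rec: "\<And>n. f (Suc n) = r n * f n" and lim: "r \<longlonglongrightarrow> l" and l: "norm l < 1"
  shows "summable (\<lambda>n. norm (f n))"
proof -
  obtain c where c: "norm l < c" "c < 1" using l dense by blast
  have "(\<lambda>n. norm (r n)) \<longlonglongrightarrow> norm l" by (intro tendsto_intros lim)
  then have "eventually (\<lambda>n. norm (r n) < c) sequentially"
    using c(1) by (rule order_tendstoD)
  then obtain N where N: "\<And>n. n \<ge> N \<Longrightarrow> norm (r n) < c"
    by (auto simp: eventually_sequentially)
  show ?thesis
  proof (rule summable_ratio_test[OF c(2)])
    fix n assume "n \<ge> N"
    then show "norm (norm (f (Suc n))) \<le> c * norm (norm (f n))"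
      using N[of n] by (simp add: rec norm_mult mult_right_mono)
  qed
qed

lemma abs_summable_on_product:
  fixes f :: "'a \<Rightarrow> complex" and g :: "'b \<Rightarrow> complex"
  assumes "(\<lambda>x. norm (f x)) summable_on A" "(\<lambda>y. norm (g y)) summable_on B"
  shows "(\<lambda>(x, y). norm (f x * g y)) summable_on A \<times> B"
  using Infinite_Sum.abs_summable_on_Sigma_iff[where f = "\<lambda>(x, y). f x * g y" and A = A and B = "\<lambda>_. B"] assms
  by (auto simp: norm_mult infsum_cmult_right' abs_mult case_prod_unfold
      intro!: summable_on_cmult_right summable_on_cmult_left)

text \<open>Absolute convergence makes the family summable over the product set; summing the second
  variable first then identifies the value.\<close>

lemma has_sum_product:
  fixes f :: "'a \<Rightarrow> complex" and g :: "'b \<Rightarrow> complex"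
  assumes "(\<lambda>x. norm (f x)) summable_on A" "(\<lambda>y. norm (g y)) summable_on B" "(f has_sum F) A" "(g has_sum G) B"
  shows "((\<lambda>(x, y). f x * g y) has_sum F * G) (A \<times> B)"
proof -
  have "(\<lambda>w. norm ((\<lambda>(x, y). f x * g y) w)) summable_on A \<times> B"
    using abs_summable_on_product[OF assms(1,2)] by (simp add: case_prod_unfold)
  then have "(\<lambda>(x, y). f x * g y) summable_on A \<times> B"
    by (rule abs_summable_summable)
  then obtain S where S: "((\<lambda>(x, y). f x * g y) has_sum S) (A \<times> B)"
    by (auto simp: summable_on_def)
  have "((\<lambda>x. f x * G) has_sum S) A"
    by (rule has_sum_SigmaD[OF S]) (auto intro: has_sum_cmult_right assms)
  moreover have "((\<lambda>x. f x * G) has_sum F * G) A"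
    by (intro has_sum_cmult_left assms)
  ultimately show ?thesis
    using S has_sum_unique by blast
qed

subsection \<open>Infinite products and Euler's expansions\<close>

lemma qpoch_LIMSEQ:
  assumes "norm r < 1"
  shows "(\<lambda>n. \<Prod>k<n. 1 - c * r ^ k) \<longlonglongrightarrow> qpoch c r"
  unfolding qpoch_def
  by (rule has_prod_imp_tendsto' convergent_prod_has_prod convergent_prod_qpoch assms)+

text \<open>A vanishing factor kills all later partial products, while a convergent product without
  vanishing factors has a nonzero limit.\<close>

lemma qpoch_eq_0_iff:
  assumes "norm r < 1"
  shows "qpoch c r = 0 \<longleftrightarrow> (\<exists>k. c * r ^ k = 1)"
proof
  assume "\<exists>k. c * r ^ k = 1"
  then obtain k where "1 - c * r ^ k = 0" by auto
  then have "eventually (\<lambda>n. (\<Prod>k<n. 1 - c * r ^ k) = 0) sequentially"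
    by (intro eventually_sequentiallyI[of "Suc k"]) auto
  then have "(\<lambda>n. \<Prod>k<n. 1 - c * r ^ k) \<longlonglongrightarrow> 0"
    by (rule tendsto_eventually)
  then show "qpoch c r = 0"
    using qpoch_LIMSEQ[OF assms] LIMSEQ_unique by blast
next
  assume "qpoch c r = 0"
  then show "\<exists>k. c * r ^ k = 1"
    using prodinf_nonzero[OF convergent_prod_qpoch[OF assms, of c]]
    unfolding qpoch_def by force
qed

lemma qpoch_split:
  assumes "norm r < 1"
  shows "qpoch c r = (\<Prod>k<n. 1 - c * r ^ k) * qpoch (c * r ^ n) r"
proof -
  have "(\<lambda>m. (\<Prod>k<n. 1 - c * r ^ k) * (\<Prod>k<m. 1 - c * r ^ n * r ^ k))
      \<longlonglongrightarrow> (\<Prod>k<n. 1 - c * r ^ k) * qpoch (c * r ^ n) r"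
    by (intro tendsto_intros qpoch_LIMSEQ assms)
  moreover have "(\<Prod>k<n. 1 - c * r ^ k) * (\<Prod>k<m. 1 - c * r ^ n * r ^ k)
      = (\<Prod>k<m + n. 1 - c * r ^ k)" for m
    by (induction m) (simp_all add: power_add mult_ac add.commute[of n])
  ultimately have "(\<lambda>m. \<Prod>k<m + n. 1 - c * r ^ k)
      \<longlonglongrightarrow> (\<Prod>k<n. 1 - c * r ^ k) * qpoch (c * r ^ n) r"
    by simp
  then show ?thesis
    using LIMSEQ_ignore_initial_segment[OF qpoch_LIMSEQ[OF assms, of c], of n]
      LIMSEQ_unique by blast
qed

text \<open>This is (-1)^k p^(k(k-1)/2) / (p;p)_k, the coefficient of x^k in (x;p). The product form
  makes the ratio of consecutive coefficients immediate.\<close>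

definition euler_A :: "complex \<Rightarrow> nat \<Rightarrow> complex"
  where "euler_A p k = (\<Prod>j<k. - (p ^ j) / (1 - p ^ Suc j))"

text \<open>This is 1 / (p;p)_k, the coefficient of x^k in 1 / (x;p).\<close>

definition euler_B :: "complex \<Rightarrow> nat \<Rightarrow> complex"
  where "euler_B p k = (\<Prod>j<k. 1 / (1 - p ^ Suc j))"

lemma power_Suc_neq_1:
  fixes p :: complex
  assumes "norm p < 1"
  shows "p ^ Suc k \<noteq> 1"
  using power_less_one_iff[of "norm p" "Suc k"] assms
  by (metis norm_ge_zero norm_one norm_power order_less_irrefl zero_less_Suc)

lemma tendsto_inverse_one_minus_power:
  fixes p :: complex
  assumes "norm p < 1"
  shows "(\<lambda>k. 1 / (1 - p ^ Suc k)) \<longlonglongrightarrow> 1"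
proof -
  have "(\<lambda>k. p ^ Suc k) \<longlonglongrightarrow> 0"
    using LIMSEQ_power_zero[OF assms] by (rule LIMSEQ_Suc)
  then have "(\<lambda>k. 1 / (1 - p ^ Suc k)) \<longlonglongrightarrow> 1 / (1 - 0)"
    by (intro tendsto_intros) auto
  then show ?thesis by simp
qed

lemma summable_euler_A:
  assumes p: "norm p < 1"
  shows "summable (\<lambda>k. norm (euler_A p k * x ^ k))"
proof (rule summable_norm_ratio_limit)
  show "euler_A p (Suc k) * x ^ Suc k = - x * p ^ k * (1 / (1 - p ^ Suc k)) * (euler_A p k * x ^ k)"
    for k by (simp add: euler_A_def)
  show "(\<lambda>k. - x * p ^ k * (1 / (1 - p ^ Suc k))) \<longlonglongrightarrow> - x * 0 * 1"
    by (intro tendsto_intros tendsto_inverse_one_minus_power p LIMSEQ_power_zero)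
qed simp

lemma summable_euler_B:
  assumes p: "norm p < 1" and x: "norm x < 1"
  shows "summable (\<lambda>k. norm (euler_B p k * x ^ k))"
proof (rule summable_norm_ratio_limit)
  show "euler_B p (Suc k) * x ^ Suc k = x * (1 / (1 - p ^ Suc k)) * (euler_B p k * x ^ k)"
    for k by (simp add: euler_B_def)
  show "(\<lambda>k. x * (1 / (1 - p ^ Suc k))) \<longlonglongrightarrow> x * 1"
    by (intro tendsto_intros tendsto_inverse_one_minus_power p)
qed (use x in simp)

lemma euler_A_Suc:
  assumes "norm p < 1"
  shows "euler_A p (Suc k) * (1 - p ^ Suc k) = - (p ^ k) * euler_A p k"
  using power_Suc_neq_1[OF assms, of k] by (simp add: euler_A_def)

lemma euler_B_Suc:
  assumes "norm p < 1"
  shows "euler_B p (Suc k) * (1 - p ^ Suc k) = euler_B p k"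
  using power_Suc_neq_1[OF assms, of k] by (simp add: euler_B_def)

text \<open>The coefficient recurrence gives the functional equation
  \<open>f x = (1 - x) * f (x * p)\<close>. Iterating it peels off the factors of the product, and
  continuity at 0 with \<open>f 0 = 1\<close> handles the remainder.\<close>

lemma euler_A_sums_qpoch:
  assumes p: "norm p < 1"
  shows "(\<lambda>k. euler_A p k * x ^ k) sums qpoch x p"
proof -
  define f where "f = (\<lambda>x. \<Sum>k. euler_A p k * x ^ k)"
  have s: "summable (\<lambda>k. euler_A p k * x ^ k)" for x
    using summable_euler_A[OF p] by (rule summable_norm_cancel)
  have fs: "(\<lambda>k. euler_A p k * x ^ k) sums f x" for x
    unfolding f_def using s by (rule summable_sums)
  have step: "f x = (1 - x) * f (x * p)" for x
  proof -
    have "(\<lambda>k. euler_A p k * x ^ k - euler_A p k * (x * p) ^ k) sums (f x - f (x * p))"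
      by (intro sums_diff fs)
    \<comment> \<open>The terms at index 0 cancel, so the index can be moved up by one to apply the
      recurrence.\<close>
    then have "(\<lambda>k. euler_A p (Suc k) * x ^ Suc k - euler_A p (Suc k) * (x * p) ^ Suc k)
        sums (f x - f (x * p))"
      by (subst sums_Suc_iff) simp
    moreover have "euler_A p (Suc k) * x ^ Suc k - euler_A p (Suc k) * (x * p) ^ Suc k
        = - x * (euler_A p k * (x * p) ^ k)" for k
    proof -
      have "euler_A p (Suc k) * x ^ Suc k - euler_A p (Suc k) * (x * p) ^ Suc k
          = euler_A p (Suc k) * (1 - p ^ Suc k) * x ^ Suc k"
        by (simp add: power_mult_distrib algebra_simps)
      also have "\<dots> = - x * (euler_A p k * (x * p) ^ k)"
        unfolding euler_A_Suc[OF p] by (simp add: power_mult_distrib)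
      finally show ?thesis .
    qed
    ultimately have "(\<lambda>k. - x * (euler_A p k * (x * p) ^ k)) sums (f x - f (x * p))"
      by simp
    moreover have "(\<lambda>k. - x * (euler_A p k * (x * p) ^ k)) sums (- x * f (x * p))"
      by (intro sums_mult fs)
    ultimately have "f x - f (x * p) = - x * f (x * p)"
      by (rule sums_unique2)
    then show ?thesis by (simp add: algebra_simps)
  qed
  have iter: "f x = (\<Prod>k<n. 1 - x * p ^ k) * f (x * p ^ n)" for n
  proof (induction n)
    case (Suc n)
    have "f (x * p ^ n) = (1 - x * p ^ n) * f (x * p ^ Suc n)"
      using step[of "x * p ^ n"] by (simp add: mult_ac)
    with Suc show ?case by simp
  qed simp
  have "isCont f 0"
    unfolding f_def by (rule isCont_powser_converges_everywhere) (rule s)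
  moreover have "(\<lambda>n. x * p ^ n) \<longlonglongrightarrow> x * 0"
    by (intro tendsto_intros LIMSEQ_power_zero p)
  ultimately have "(\<lambda>n. f (x * p ^ n)) \<longlonglongrightarrow> f 0"
    by (auto intro: isCont_tendsto_compose)
  then have "(\<lambda>n. (\<Prod>k<n. 1 - x * p ^ k) * f (x * p ^ n)) \<longlonglongrightarrow> qpoch x p * f 0"
    by (intro tendsto_intros qpoch_LIMSEQ p)
  then have "(\<lambda>n. f x) \<longlonglongrightarrow> qpoch x p * f 0"
    unfolding iter[symmetric] .
  then have "f x = qpoch x p * f 0"
    by (intro LIMSEQ_unique[OF tendsto_const])
  moreover have "f 0 = 1" by (simp add: f_def euler_A_def)
  ultimately have "f x = qpoch x p"
    by simp
  then show ?thesis using fs[of x] by simp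
qed

text \<open>The same argument with the reciprocal functional equation, inside the unit disc. The
  limit gives \<open>qpoch x p * f x = 1\<close>, which also shows that the product does not
  vanish.\<close>

lemma euler_B_sums:
  assumes p: "norm p < 1" and x: "norm x < 1"
  shows "(\<lambda>k. euler_B p k * x ^ k) sums (1 / qpoch x p)"
proof -
  define f where "f = (\<lambda>x. \<Sum>k. euler_B p k * x ^ k)"
  have s: "summable (\<lambda>k. euler_B p k * x ^ k)" if "norm x < 1" for x
    using summable_euler_B[OF p that] by (rule summable_norm_cancel)
  have fs: "(\<lambda>k. euler_B p k * x ^ k) sums f x" if "norm x < 1" for x
    unfolding f_def using s that by (intro summable_sums)
  have xp: "norm (x * p ^ n) < 1" for n
  proof -
    have "norm (x * p ^ n) \<le> norm x * 1"
      unfolding norm_mult norm_power using p by (intro mult_left_mono power_le_one) auto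
    then show ?thesis using x by simp
  qed
  have step: "f (x * p) = (1 - x) * f x" if x: "norm x < 1" "norm (x * p) < 1" for x
  proof -
    have "(\<lambda>k. euler_B p k * x ^ k - euler_B p k * (x * p) ^ k) sums (f x - f (x * p))"
      using x by (intro sums_diff fs)
    then have "(\<lambda>k. euler_B p (Suc k) * x ^ Suc k - euler_B p (Suc k) * (x * p) ^ Suc k)
        sums (f x - f (x * p))"
      by (subst sums_Suc_iff) simp
    moreover have "euler_B p (Suc k) * x ^ Suc k - euler_B p (Suc k) * (x * p) ^ Suc k
        = x * (euler_B p k * x ^ k)" for k
    proof -
      have "euler_B p (Suc k) * x ^ Suc k - euler_B p (Suc k) * (x * p) ^ Suc k
          = euler_B p (Suc k) * (1 - p ^ Suc k) * x ^ Suc k"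
        by (simp add: power_mult_distrib algebra_simps)
      also have "\<dots> = x * (euler_B p k * x ^ k)"
        unfolding euler_B_Suc[OF p] by simp
      finally show ?thesis .
    qed
    ultimately have "(\<lambda>k. x * (euler_B p k * x ^ k)) sums (f x - f (x * p))"
      by simp
    moreover have "(\<lambda>k. x * (euler_B p k * x ^ k)) sums (x * f x)"
      using x by (intro sums_mult fs)
    ultimately have "f x - f (x * p) = x * f x"
      by (rule sums_unique2)
    then show ?thesis by (simp add: algebra_simps)
  qed
  have iter: "f (x * p ^ n) = (\<Prod>k<n. 1 - x * p ^ k) * f x" for n
  proof (induction n)
    case (Suc n)
    have "f (x * p ^ Suc n) = (1 - x * p ^ n) * f (x * p ^ n)"
      using step[of "x * p ^ n"] xp[of n] xp[of "Suc n"] by (simp add: mult_ac)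
    then show ?case using Suc by simp
  qed simp
  have "isCont f 0"
    unfolding f_def by (rule isCont_powser[of _ "1/2"]) (auto intro: s)
  moreover have "(\<lambda>n. x * p ^ n) \<longlonglongrightarrow> x * 0"
    by (intro tendsto_intros LIMSEQ_power_zero p)
  ultimately have "(\<lambda>n. f (x * p ^ n)) \<longlonglongrightarrow> f 0"
    by (auto intro: isCont_tendsto_compose)
  moreover have "(\<lambda>n. f (x * p ^ n)) \<longlonglongrightarrow> qpoch x p * f x"
    unfolding iter by (intro tendsto_intros qpoch_LIMSEQ p)
  moreover have "f 0 = 1" by (simp add: f_def euler_B_def)
  ultimately have "qpoch x p * f x = 1"
    using LIMSEQ_unique[of "\<lambda>n. f (x * p ^ n)" "f 0" "qpoch x p * f x"] by metis
  then have "f x = 1 / qpoch x p"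
    by (cases "qpoch x p = 0") (simp_all add: field_simps)
  then show ?thesis using fs[OF x] by simp
qed

text \<open>Euler's expansion presents \<open>qpoch\<close> as an everywhere convergent power series
  in its first argument.\<close>

lemma continuous_on_qpoch:
  assumes "norm p < 1" "continuous_on S f"
  shows "continuous_on S (\<lambda>x. qpoch (f x) p)"
proof -
  have "qpoch x p = (\<Sum>k. euler_A p k * x ^ k)" for x
    using euler_A_sums_qpoch[OF assms(1)] by (rule sums_unique)
  moreover have "isCont (\<lambda>x. \<Sum>k. euler_A p k * x ^ k) x" for x
    by (rule isCont_powser_converges_everywhere)
      (rule summable_norm_cancel, rule summable_euler_A[OF assms(1)])
  ultimately have "isCont (\<lambda>x. qpoch x p) x" for x
    by simp
  then have "continuous_on UNIV (\<lambda>x. qpoch x p)"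
    by (simp add: continuous_at_imp_continuous_on)
  then show ?thesis
    using continuous_on_compose2[OF _ assms(2)] by blast
qed

lemma euler_A_has_sum:
  assumes "norm p < 1"
  shows "((\<lambda>k. euler_A p k * x ^ k) has_sum qpoch x p) UNIV"
  by (rule norm_summable_imp_has_sum summable_euler_A euler_A_sums_qpoch assms)+

lemma euler_A_abs_summable:
  assumes "norm p < 1"
  shows "(\<lambda>k. norm (euler_A p k * x ^ k)) summable_on UNIV"
  by (subst summable_on_UNIV_nonneg_real_iff) (auto intro: summable_euler_A assms)

section \<open>Bilateral theta series and the shift of the summation index\<close>

definition gauss :: "complex \<Rightarrow> int \<Rightarrow> complex"
  where "gauss q n = q powi (n * (n - 1) div 2)"

text \<open>The series side of the Jacobi triple product; the product side is \<open>qtheta\<close>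
  below.\<close>

definition jtheta :: "complex \<Rightarrow> complex \<Rightarrow> complex"
  where "jtheta q u = (\<Sum>\<^sub>\<infinity>n\<in>UNIV. u powi n * gauss q n)"

lemma gauss_nonzero [simp]: "q \<noteq> 0 \<Longrightarrow> gauss q n \<noteq> 0"
  by (simp add: gauss_def)

lemma gauss_0 [simp]: "gauss q 0 = 1" and gauss_1 [simp]: "gauss q 1 = 1"
  by (simp_all add: gauss_def)

text \<open>Polarization of the quadratic exponent n(n-1)/2: the cross term is \<open>m * n\<close>.
  Since n(n-1) is even, \<open>div 2\<close> loses nothing.\<close>

lemma gauss_add:
  assumes "q \<noteq> 0"
  shows "gauss q (m + n) = gauss q m * gauss q n * q powi (m * n)"
proof -
  have "even (m * (m - 1))" "even (n * (n - 1))"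
    by auto
  then obtain a b where ab: "m * (m - 1) = 2 * a" "n * (n - 1) = 2 * b"
    by (metis evenE)
  then have "(m + n) * (m + n - 1) = 2 * (a + b + m * n)"
    by (simp add: algebra_simps)
  then show ?thesis
    unfolding gauss_def ab using assms by (simp add: power_int_add)
qed

lemma gauss_plus_1: "q \<noteq> 0 \<Longrightarrow> gauss q (n + 1) = gauss q n * q powi n"
  by (simp add: gauss_add)

lemma gauss_uminus: "gauss q (- n) = gauss q (n + 1)"
  by (simp add: gauss_def algebra_simps)

lemma gauss_of_nat_Suc: "q \<noteq> 0 \<Longrightarrow> gauss q (int (Suc k)) = gauss q (int k) * q ^ k"
  using gauss_plus_1[of q "int k"] by (simp add: add.commute)

text \<open>When the two bases agree, dividing by \<open>gauss\<close> turns Euler's first series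
  into the second, up to sign. The triple product rests on this.\<close>

lemma euler_A_eq_euler_B:
  assumes "q \<noteq> 0"
  shows "euler_A q k = (- 1) ^ k * gauss q (int k) * euler_B q k"
  by (induction k) (simp_all add: euler_A_def euler_B_def gauss_of_nat_Suc assms del: of_nat_Suc)

text \<open>The ratio of consecutive terms contains \<open>(p / q) ^ k\<close>, which tends to 0
  because \<open>norm p < norm q\<close>.\<close>

lemma summable_euler_A_div_gauss:
  assumes pq: "norm p < norm q" and q: "norm q < 1"
  shows "summable (\<lambda>k. norm (euler_A p k / gauss q (int k) * x ^ k))"
proof (rule summable_norm_ratio_limit)
  have p: "norm p < 1" and q0: "q \<noteq> 0" using pq q by auto
  show "euler_A p (Suc k) / gauss q (int (Suc k)) * x ^ Suc k
      = - x * (p / q) ^ k * (1 / (1 - p ^ Suc k)) * (euler_A p k / gauss q (int k) * x ^ k)"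
    for k using q0 by (simp add: euler_A_def gauss_of_nat_Suc field_simps del: of_nat_Suc)
  have "norm (p / q) < 1"
    using pq by (simp add: norm_divide divide_less_eq)
  then show "(\<lambda>k. - x * (p / q) ^ k * (1 / (1 - p ^ Suc k))) \<longlonglongrightarrow> - x * 0 * 1"
    by (intro tendsto_intros tendsto_inverse_one_minus_power p LIMSEQ_power_zero)
qed simp

text \<open>For nonnegative \<open>n\<close> the ratio \<open>u * q ^ k\<close> tends to 0; the
  reflection \<open>n\<close> to \<open>- n\<close> turns the negative half into the same series
  with \<open>q / u\<close> in place of \<open>u\<close>.\<close>

lemma abs_summable_powi_gauss:
  assumes q: "q \<noteq> 0" "norm q < 1" and u: "u \<noteq> 0"
  shows "(\<lambda>n. norm (u powi n * gauss q n)) summable_on UNIV"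
proof -
  have nat: "(\<lambda>k. norm (u powi int k * gauss q (int k))) summable_on UNIV" if "u \<noteq> 0" for u
  proof -
    have "summable (\<lambda>k. norm (u powi int k * gauss q (int k)))"
    proof (rule summable_norm_ratio_limit)
      show "u powi int (Suc k) * gauss q (int (Suc k))
          = u * q ^ k * (u powi int k * gauss q (int k))" for k
        using q by (simp add: gauss_of_nat_Suc del: of_nat_Suc)
      show "(\<lambda>k. u * q ^ k) \<longlonglongrightarrow> u * 0"
        by (intro tendsto_intros LIMSEQ_power_zero q)
    qed simp
    then show ?thesis by (simp add: summable_on_UNIV_nonneg_real_iff)
  qed
  have "(\<lambda>n. norm (u powi n * gauss q n)) summable_on range int"
    using nat[OF u] by (subst summable_on_reindex) (auto simp: o_def)
  moreover have "(\<lambda>n. norm (u powi n * gauss q n)) summable_on (\<lambda>k. - int k) ` {1..}"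
  proof (subst summable_on_reindex)
    have "(\<lambda>k. norm ((q / u) powi int k * gauss q (int k))) summable_on {1..}"
      by (rule summable_on_subset_banach[OF nat]) (use q u in auto)
    moreover have "u powi (- n) * gauss q (- n) = (q / u) powi n * gauss q n" for n
      using q by (simp add: gauss_uminus gauss_plus_1 power_int_minus divide_inverse mult_ac
          power_int_mult_distrib power_int_inverse)
    ultimately show "((\<lambda>n. norm (u powi n * gauss q n)) \<circ> (\<lambda>k. - int k)) summable_on {1..}"
      by (simp add: o_def)
  qed (auto intro: inj_onI)
  ultimately have "(\<lambda>n. norm (u powi n * gauss q n)) summable_on (range int \<union> (\<lambda>k. - int k) ` {1..})"
    by (rule summable_on_Un_disjoint) auto
  also have "range int \<union> (\<lambda>k. - int k) ` {1..} = UNIV"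
  proof -
    have "n \<in> range int \<union> (\<lambda>k. - int k) ` {1..}" for n
      by (cases n rule: int_cases2) (auto simp: image_iff intro: Suc_leI)
    then show ?thesis by blast
  qed
  finally show ?thesis .
qed

lemma has_sum_jtheta:
  assumes "q \<noteq> 0" "norm q < 1" "u \<noteq> 0"
  shows "((\<lambda>n. u powi n * gauss q n) has_sum jtheta q u) UNIV"
  unfolding jtheta_def
  by (rule has_sum_infsum, rule abs_summable_summable, rule abs_summable_powi_gauss[OF assms])

text \<open>Shifting the summation index \<open>n\<close> by \<open>m k\<close> completes the square in the exponent of \<open>q\<close>,
  which separates the two summations.\<close>

lemma gauss_shift:
  assumes "q \<noteq> 0" "u \<noteq> 0"
  shows "(q powi n * u) powi m * (u powi n * gauss q n)
      = (u powi (n + m) * gauss q (n + m)) / gauss q m"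
  using assms by (simp add: gauss_add power_int_add power_int_mult_distrib mult_ac flip: power_int_mult)

text \<open>A shear combined with a swap of coordinates: the separated sum over
  \<open>K \<times> UNIV\<close> becomes a sum whose inner variable is \<open>k\<close>.\<close>

lemma bij_betw_gauss_shift:
  "bij_betw (\<lambda>(n::int, k). (k, n + m k)) (UNIV \<times> K) (K \<times> UNIV)"
  by (rule bij_betw_byWitness[where f' = "\<lambda>(k, n). (n - m k, k)"]) auto

lemma abs_summable_gauss_shift:
  fixes c :: "'a \<Rightarrow> complex" and m :: "'a \<Rightarrow> int"
  assumes q: "q \<noteq> 0" "norm q < 1" and u: "u \<noteq> 0"
    and c: "(\<lambda>k. norm (c k / gauss q (m k))) summable_on K"
  shows "(\<lambda>(n, k). norm (c k * (q powi n * u) powi m k * (u powi n * gauss q n)))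
      summable_on UNIV \<times> K"
proof -
  have "(\<lambda>(k, n). norm (c k / gauss q (m k) * (u powi n * gauss q n))) summable_on K \<times> UNIV"
    using c abs_summable_powi_gauss[OF q u] by (rule abs_summable_on_product)
  then have "(\<lambda>x. (\<lambda>(k, n). norm (c k / gauss q (m k) * (u powi n * gauss q n)))
      ((\<lambda>(n, k). (k, n + m k)) x)) summable_on UNIV \<times> K"
    by (subst summable_on_reindex_bij_betw[OF bij_betw_gauss_shift])
  then show ?thesis
    using gauss_shift[OF q(1) u] by (simp add: case_prod_unfold mult.assoc)
qed

text \<open>One double sum evaluated in two ways: separated, it is \<open>C * jtheta q u\<close>;
  summed over \<open>k\<close> first, it is the series in \<open>S n\<close>. The index set and
  \<open>m\<close> are general to cover both a single Euler series with \<open>m k = k\<close> and a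
  pair of them with exponent \<open>k - l\<close>.\<close>

lemma has_sum_gauss_shift:
  fixes c :: "'a \<Rightarrow> complex" and m :: "'a \<Rightarrow> int"
  assumes q: "q \<noteq> 0" "norm q < 1" and u: "u \<noteq> 0"
    and c: "(\<lambda>k. norm (c k / gauss q (m k))) summable_on K"
    and C: "((\<lambda>k. c k / gauss q (m k)) has_sum C) K"
    and S: "\<And>n. ((\<lambda>k. c k * (q powi n * u) powi m k) has_sum S n) K"
  shows "((\<lambda>n. S n * (u powi n * gauss q n)) has_sum C * jtheta q u) UNIV"
proof -
  have "((\<lambda>(k, n). c k / gauss q (m k) * (u powi n * gauss q n)) has_sum C * jtheta q u) (K \<times> UNIV)"
    using c abs_summable_powi_gauss[OF q u] C has_sum_jtheta[OF q u] by (rule has_sum_product)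
  then have "((\<lambda>x. (\<lambda>(k, n). c k / gauss q (m k) * (u powi n * gauss q n))
      ((\<lambda>(n, k). (k, n + m k)) x)) has_sum C * jtheta q u) (UNIV \<times> K)"
    by (subst has_sum_reindex_bij_betw[OF bij_betw_gauss_shift])
  then have "((\<lambda>(n, k). c k * (q powi n * u) powi m k * (u powi n * gauss q n))
      has_sum C * jtheta q u) (UNIV \<times> K)"
    using gauss_shift[OF q(1) u] by (simp add: case_prod_unfold mult.assoc)
  then show ?thesis
    by (rule has_sum_SigmaD) (auto intro: has_sum_cmult_left S)
qed

text \<open>Provides the domination for folding the integral. After the shift a term depends on
  \<open>t\<close> only through a power of \<open>t\<close>, whose modulus on the annulus is at most
  the sum of its values at \<open>1\<close> and \<open>R\<close>.\<close>

lemma gauss_shift_uniform_bound: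
  fixes c :: "'a \<Rightarrow> complex" and m :: "'a \<Rightarrow> int" and R :: real
  assumes q: "q \<noteq> 0" "norm q < 1" and R: "R \<ge> 1"
    and c: "(\<lambda>k. norm (c k / gauss q (m k))) summable_on K"
  obtains M where "M summable_on (UNIV :: int set)"
    and "\<And>n t S. 1 \<le> norm t \<Longrightarrow> norm t \<le> R \<Longrightarrow>
      ((\<lambda>k. c k * (q powi n * t) powi m k) has_sum S) K \<Longrightarrow>
      norm (S * (t powi n * gauss q n)) \<le> M n"
proof
  define h where "h = (\<lambda>t n k. norm (c k * (q powi n * t) powi m k * (t powi n * gauss q n)))"
  define M where "M = (\<lambda>n. infsum (h 1 n) K + infsum (h (of_real R) n) K)"
  have sum2: "(\<lambda>(n, k). h u n k) summable_on UNIV \<times> K" if "u \<noteq> 0" for u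
    unfolding h_def by (rule abs_summable_gauss_shift[OF q that c])
  have sum1: "h u n summable_on K" if "u \<noteq> 0" for u n
    using summable_on_SigmaD1[OF sum2[OF that], of n] by simp
  have R0: "complex_of_real R \<noteq> 0" using R by simp
  show "M summable_on UNIV"
    unfolding M_def using summable_on_Sigma_banach[OF sum2] R0 by (intro summable_on_add) auto
  fix n :: int and t S
  assume t: "1 \<le> norm t" "norm t \<le> R"
    and S: "((\<lambda>k. c k * (q powi n * t) powi m k) has_sum S) K"
  have t0: "t \<noteq> 0" using t by auto
  have le: "h t n k \<le> h 1 n k + h (of_real R) n k" for k
  proof -
    \<comment> \<open>For \<open>j \<ge> 0\<close> the power is at most its value at
      \<open>R\<close>, for \<open>j < 0\<close> at most its value at 1.\<close>
    have powi: "norm t powi j \<le> 1 + R powi j" for j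
    proof (cases "j \<ge> 0")
      case True
      then have "norm t powi j \<le> R powi j"
        using t by (intro power_int_mono) auto
      then show ?thesis by simp
    next
      case False
      then have "1 \<le> norm t powi (- j)"
        using t by (intro one_le_power_int) auto
      then have "norm t powi j \<le> 1"
        unfolding power_int_minus by (subst (asm) one_le_inverse_iff) simp
      moreover have "R powi j \<ge> 0" using R by simp
      ultimately show ?thesis by linarith
    qed
    have eq: "h u n k = norm (c k) * norm (gauss q (n + m k) / gauss q (m k)) * norm u powi (n + m k)"
      if "u \<noteq> 0" for u
      unfolding h_def mult.assoc gauss_shift[OF q(1) that]
      by (simp add: norm_mult norm_divide norm_power_int)
    have "h t n k \<le> norm (c k) * norm (gauss q (n + m k) / gauss q (m k)) * (1 + R powi (n + m k))"
      unfolding eq[OF t0] by (intro mult_left_mono powi) auto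
    also have "\<dots> = h 1 n k + h (of_real R) n k"
      using R by (simp add: eq[OF R0] eq[of 1] algebra_simps)
    finally show ?thesis .
  qed
  have "((\<lambda>k. c k * (q powi n * t) powi m k * (t powi n * gauss q n))
      has_sum S * (t powi n * gauss q n)) K"
    using S by (rule has_sum_cmult_left)
  then have "norm (S * (t powi n * gauss q n)) \<le> infsum (h t n) K"
    using norm_infsum_bound[OF sum1[OF t0, of n, unfolded h_def]] by (simp add: infsumI h_def)
  also have "\<dots> \<le> infsum (\<lambda>k. h 1 n k + h (of_real R) n k) K"
    by (intro infsum_mono sum1 summable_on_add t0 R0 le) auto
  also have "\<dots> = M n"
    unfolding M_def by (intro infsum_add sum1 R0) auto
  finally show "norm (S * (t powi n * gauss q n)) \<le> M n" .
qed

subsection \<open>The Jacobi triple product\<close>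

definition qtheta :: "complex \<Rightarrow> complex \<Rightarrow> complex"
  where "qtheta q u = qpoch (- u) q * qpoch (- q / u) q"

text \<open>Multiplying by \<open>u powi n * gauss q n\<close> completes the square, so both sides
  are the same series up to a translation of the index.\<close>

lemma jtheta_quasiperiodic:
  assumes "q \<noteq> 0" "norm q < 1" "u \<noteq> 0"
  shows "jtheta q (q powi n * u) * (u powi n * gauss q n) = jtheta q u"
proof -
  have "((\<lambda>m. (q powi n * u) powi m * gauss q m * (u powi n * gauss q n))
      has_sum jtheta q (q powi n * u) * (u powi n * gauss q n)) UNIV"
    using assms by (intro has_sum_cmult_left has_sum_jtheta) auto
  moreover have "(q powi n * u) powi m * gauss q m * (u powi n * gauss q n)
      = u powi (n + m) * gauss q (n + m)" for m
    using gauss_shift[of q u n m] assms by (simp add: field_simps)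
  moreover have "((\<lambda>m. u powi (n + m) * gauss q (n + m)) has_sum jtheta q u) UNIV"
    using has_sum_jtheta[OF assms]
    by (subst has_sum_reindex_bij_betw[where g = "\<lambda>m. n + m" and B = UNIV])
      (auto intro!: bij_betwI[where g = "\<lambda>m. m - n"])
  ultimately show ?thesis
    by (auto dest: has_sum_unique)
qed

text \<open>Passing from \<open>u\<close> to \<open>q * u\<close> removes the factor
  \<open>1 + u\<close> from one product and adds \<open>1 + 1 / u\<close> to the other.\<close>

lemma qtheta_quasiperiodic:
  assumes "q \<noteq> 0" "norm q < 1" "u \<noteq> 0"
  shows "qtheta q (q * u) = qtheta q u / u"
proof (cases "u = - 1")
  \<comment> \<open>Here both sides contain the vanishing factor \<open>qpoch 1 q\<close>.\<close>
  case True
  have "qpoch 1 q = 0"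
    using qpoch_eq_0_iff[OF assms(2)] by (metis mult_1 power_0)
  then show ?thesis
    using True assms by (simp add: qtheta_def)
next
  case False
  then have u: "1 + u \<noteq> 0" by (simp add: add_eq_0_iff)
  have f1: "qpoch (- u) q = (1 + u) * qpoch (- (q * u)) q"
    using qpoch_split[OF assms(2), of "- u" 1] by (simp add: mult.commute)
  moreover have "qpoch (- 1 / u) q = (1 + 1 / u) * qpoch (- q / u) q"
    using qpoch_split[OF assms(2), of "- 1 / u" 1] by simp
  ultimately have "u * qpoch (- 1 / u) q = (1 + u) * qpoch (- q / u) q"
    using assms by (simp add: field_simps)
  then have "qpoch (- 1 / u) q = (1 + u) * qpoch (- q / u) q / u"
    using assms by (simp add: field_simps)
  moreover have "- q / (q * u) = - 1 / u"
    using assms by simp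
  ultimately show ?thesis
    using f1 by (simp add: qtheta_def)
qed

text \<open>The sum over \<open>n\<close> of
  \<open>qpoch (q powi (n + 1)) q * (u powi n * gauss q n)\<close> is evaluated in two ways: by the
  index shift, which produces \<open>jtheta\<close>, and directly by Euler's first series. The
  condition on \<open>u\<close> puts \<open>- (q / u)\<close> inside the disc where Euler's second
  series converges.\<close>

lemma jtheta_eq_qtheta_annulus:
  assumes q: "q \<noteq> 0" "norm q < 1" and u: "norm q < norm u"
  shows "jtheta q u = qpoch q q * qtheta q u"
proof -
  have u0: "u \<noteq> 0" using u by auto
  have qu: "norm (- (q / u)) < 1" using u by (simp add: norm_divide divide_less_eq)
  have coeff: "euler_A q k * (q / u) ^ k / gauss q (int k) = euler_B q k * (- (q / u)) ^ k" for k
    using q by (simp add: euler_A_eq_euler_B power_minus[of "q / u"])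
  have "((\<lambda>n. qpoch (q powi (n + 1)) q * (u powi n * gauss q n))
      has_sum 1 / qpoch (- (q / u)) q * jtheta q u) UNIV"
  proof (rule has_sum_gauss_shift[OF q u0])
    show "(\<lambda>k. norm (euler_A q k * (q / u) ^ k / gauss q (int k))) summable_on UNIV"
      unfolding coeff by (subst summable_on_UNIV_nonneg_real_iff) (auto intro: summable_euler_B q qu)
    show "((\<lambda>k. euler_A q k * (q / u) ^ k / gauss q (int k)) has_sum 1 / qpoch (- (q / u)) q) UNIV"
      unfolding coeff by (intro norm_summable_imp_has_sum summable_euler_B euler_B_sums q qu)
    \<comment> \<open>The coefficient \<open>(q / u) ^ k\<close> cancels the power of
      \<open>u\<close> from the shift and raises the exponent of \<open>q\<close> from
      \<open>n\<close> to \<open>n + 1\<close>.\<close>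
    have "(q / u) ^ k * (q powi n * u) powi int k = (q powi (n + 1)) ^ k" for n k
      using u0 q by (simp add: power_mult_distrib power_int_add power_divide mult_ac)
    then show "((\<lambda>k. euler_A q k * (q / u) ^ k * (q powi n * u) powi int k)
        has_sum qpoch (q powi (n + 1)) q) UNIV" for n
      using euler_A_has_sum[OF q(2), of "q powi (n + 1)"] by (simp add: mult.assoc)
  qed
  \<comment> \<open>Direct evaluation: for \<open>n \<ge> 0\<close> the product is (q;q) divided by
    (q;q)_n, and for \<open>n < 0\<close> it contains a zero factor.\<close>
  moreover have "((\<lambda>n. qpoch (q powi (n + 1)) q * (u powi n * gauss q n))
      has_sum qpoch q q * qpoch (- u) q) UNIV"
  proof -
    have eq: "qpoch q q * (euler_A q k * (- u) ^ k)
        = qpoch (q powi (int k + 1)) q * (u powi int k * gauss q (int k))" for k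
    proof -
      have "qpoch q q = (\<Prod>j<k. 1 - q ^ Suc j) * qpoch (q powi (int k + 1)) q"
        using qpoch_split[OF q(2), of q k] q by (simp add: power_int_add mult.commute)
      moreover have "(\<Prod>j<k. 1 - q ^ Suc j) * euler_B q k = 1"
        unfolding euler_B_def prod.distrib[symmetric]
        using power_Suc_neq_1[OF q(2)] by (intro prod.neutral) auto
      ultimately have "qpoch q q * euler_B q k = qpoch (q powi (int k + 1)) q"
        by (simp add: mult_ac)
      then show ?thesis
        using q by (simp add: euler_A_eq_euler_B power_minus[of u] mult_ac)
    qed
    have "((\<lambda>k. qpoch q q * (euler_A q k * (- u) ^ k)) has_sum qpoch q q * qpoch (- u) q) UNIV"
      by (intro has_sum_cmult_right euler_A_has_sum q)
    then have "((\<lambda>n. qpoch (q powi (n + 1)) q * (u powi n * gauss q n))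
        has_sum qpoch q q * qpoch (- u) q) (range int)"
      unfolding eq by (subst has_sum_reindex) (auto simp: o_def)
    moreover have "qpoch (q powi (n + 1)) q = 0" if "n \<notin> range int" for n
    proof -
      have "n < 0" using that by (metis nonneg_int_cases not_le rangeI)
      then have "q powi (n + 1) * q ^ nat (- n - 1) = 1"
        using q by (simp flip: power_int_of_nat power_int_add)
      then show ?thesis
        using qpoch_eq_0_iff[OF q(2)] by blast
    qed
    ultimately show ?thesis
      by (subst has_sum_cong_neutral[where T = "range int"
            and g = "\<lambda>n. qpoch (q powi (n + 1)) q * (u powi n * gauss q n)"]) auto
  qed
  ultimately have "1 / qpoch (- (q / u)) q * jtheta q u = qpoch q q * qpoch (- u) q"
    by (rule has_sum_unique)
  moreover have "qpoch (- (q / u)) q \<noteq> 0"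
  proof
    assume "qpoch (- (q / u)) q = 0"
    then obtain k where "(- (q / u)) * q ^ k = 1"
      using qpoch_eq_0_iff[OF q(2)] by blast
    moreover have "norm ((- (q / u)) * q ^ k) \<le> norm (- (q / u)) * 1"
      unfolding norm_mult norm_power using q by (intro mult_left_mono power_le_one) auto
    ultimately show False using qu by (metis mult.right_neutral norm_one not_less)
  qed
  ultimately show ?thesis
    by (simp add: qtheta_def divide_eq_eq mult_ac)
qed

text \<open>Both sides obey the same quasi-periodicity, so the identity spreads from the region
  \<open>norm q < norm u\<close> to ever smaller \<open>u\<close> by replacing \<open>u\<close> with
  \<open>u / q\<close>.\<close>

theorem jacobi_triple_product:
  assumes q: "q \<noteq> 0" "norm q < 1" and u: "u \<noteq> 0"
  shows "jtheta q u = qpoch q q * qtheta q u"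
proof -
  have "jtheta q u = qpoch q q * qtheta q u" if "u \<noteq> 0" "norm q ^ Suc N < norm u" for N u
    using that
  proof (induction N arbitrary: u)
    case 0
    then show ?case by (intro jtheta_eq_qtheta_annulus q) simp
  next
    case (Suc N)
    have "norm q ^ Suc N < norm (u / q)"
      using Suc.prems q by (simp add: norm_divide less_divide_eq mult_ac)
    then have "jtheta q (u / q) = qpoch q q * qtheta q (u / q)"
      using Suc q by simp
    moreover have "jtheta q u = jtheta q (u / q) * (q / u)"
      using jtheta_quasiperiodic[OF q, of "u / q" 1] q Suc.prems by (simp add: field_simps)
    moreover have "qtheta q u = qtheta q (u / q) * (q / u)"
      using qtheta_quasiperiodic[OF q, of "u / q"] q Suc.prems by (simp add: field_simps)
    ultimately show ?case
      by simp
  qed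
  moreover obtain N where "norm q ^ N < norm u"
    using real_arch_pow_inv[of "norm u" "norm q"] u q by auto
  then have "norm q ^ Suc N < norm u"
    using q power_decreasing[of N "Suc N" "norm q"] by (intro order.strict_trans1[of "norm q ^ Suc N"]) auto
  ultimately show ?thesis using u by blast
qed

subsection \<open>Folding an integral over the real line\<close>

text \<open>The line is cut into unit intervals, each is translated to [0,1), and sum and integral
  are exchanged with \<open>M\<close> as majorant. The folded integrand is the constant
  \<open>C\<close> on an interval of length 1.\<close>

lemma integral_fold_unit_interval:
  fixes G :: "real \<Rightarrow> complex" and M :: "int \<Rightarrow> real"
  assumes cont: "continuous_on UNIV G"
    and M: "M summable_on UNIV"
    and bound: "\<And>n s. 0 \<le> s \<Longrightarrow> s \<le> 1 \<Longrightarrow> norm (G (s - of_int n)) \<le> M n"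
    and sum: "\<And>s. 0 \<le> s \<Longrightarrow> s \<le> 1 \<Longrightarrow> ((\<lambda>n. G (s - of_int n)) has_sum C) UNIV"
  shows "G absolutely_integrable_on UNIV" and "integral UNIV G = C"
proof -
  \<comment> \<open>\<open>f i\<close> is a piece of \<open>G\<close> and \<open>g i\<close> its
    translate. Half-open intervals partition the line, and \<open>int_decode\<close> enumerates them
    by naturals for the theorems on series of integrals.\<close>
  define f where "f = (\<lambda>i x. indicator {- of_int (int_decode i)..<1 - of_int (int_decode i)} x *\<^sub>R G x)"
  define g where "g = (\<lambda>i s. indicator {0..<1::real} s *\<^sub>R G (s - of_int (int_decode i)))"
  have fg: "f i (s - of_int (int_decode i)) = g i s" for i s
    by (auto simp: f_def g_def indicator_def)
  have int_f: "integrable lborel (f i)" for i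
  proof -
    have "set_integrable lborel {- of_int (int_decode i)..1 - of_int (int_decode i)} G"
      by (rule borel_integrable_atLeastAtMost') (rule continuous_on_subset[OF cont], simp)
    then have "set_integrable lborel {- of_int (int_decode i)..<1 - of_int (int_decode i)} G"
      by (rule set_integrable_subset) auto
    then show ?thesis by (simp add: set_integrable_def f_def)
  qed
  have int_g: "integrable lborel (g i)" for i
    using lborel_integrable_real_affine[OF int_f, of 1 i "- of_int (int_decode i)"] by (simp add: fg)
  have eq: "integral\<^sup>L lborel (f i) = integral\<^sup>L lborel (g i)" for i
    using lborel_integral_real_affine[of 1 "f i" "- of_int (int_decode i)"] by (simp add: fg)
  have eq_norm: "(LBINT x. norm (f i x)) = (LBINT s. norm (g i s))" for i
    using lborel_integral_real_affine[of 1 "\<lambda>x. norm (f i x)" "- of_int (int_decode i)"] by (simp add: fg)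
  have M_dec: "summable (\<lambda>i. M (int_decode i))"
    using M by (subst (asm) summable_on_reindex_bij_betw[OF bij_int_decode, symmetric])
       (rule summable_on_imp_summable)
  have g_le: "norm (g i s) \<le> indicator {0..<1} s * M (int_decode i)" for i s
    using bound by (auto simp: g_def indicator_def)
  have summable_int: "summable (\<lambda>i. LBINT s. norm (g i s))"
  proof (rule summable_comparison_test'[OF M_dec])
    fix i :: nat
    have "(LBINT s. norm (g i s)) \<le> (LBINT s. indicator {0..<1::real} s * M (int_decode i))"
      by (intro integral_mono integrable_norm int_g g_le) simp
    also have "\<dots> = M (int_decode i)" by simp
    finally show "norm (LBINT s. norm (g i s)) \<le> M (int_decode i)" by simp
  qed
  \<comment> \<open>At each point exactly one piece is active, the one selected by the
    floor.\<close>
  have f_single: "f i x = (if i = int_encode (- \<lfloor>x\<rfloor>) then G x else 0)" for i x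
  proof -
    have "x \<in> {- of_int (int_decode i)..<1 - of_int (int_decode i)} \<longleftrightarrow> \<lfloor>x\<rfloor> = - int_decode i"
      by (auto simp: floor_eq_iff)
    also have "\<dots> \<longleftrightarrow> i = int_encode (- \<lfloor>x\<rfloor>)"
      by (metis int_decode_inverse int_encode_inverse minus_minus)
    finally show ?thesis by (simp add: f_def indicator_def)
  qed
  have f_sums: "(\<lambda>i. f i x) sums G x" for x
    unfolding f_single using sums_single[of _ "\<lambda>_. G x"] .
  have f_summable: "summable (\<lambda>i. norm (f i x))" for x
    unfolding f_single by (rule summable_finite[of "{int_encode (- \<lfloor>x\<rfloor>)}"]) auto
  have G_eq: "(\<Sum>i. f i x) = G x" for x
    using f_sums by (rule sums_unique[symmetric])
  have "integrable lborel (\<lambda>x. \<Sum>i. f i x)"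
    by (rule integrable_suminf) (simp_all add: int_f f_summable eq_norm summable_int)
  then have int_G: "integrable lborel G"
    by (simp add: G_eq)
  have "(\<lambda>i. integral\<^sup>L lborel (f i)) sums (LBINT x. \<Sum>i. f i x)"
    by (rule sums_integral) (simp_all add: int_f f_summable eq_norm summable_int)
  then have sums_G: "(\<lambda>i. integral\<^sup>L lborel (g i)) sums integral\<^sup>L lborel G"
    by (simp add: G_eq eq)
  have g_sum: "(\<Sum>i. g i s) = indicator {0..<1} s *\<^sub>R C" for s
  proof (cases "s \<in> {0..<1}")
    case True
    then have "((\<lambda>i. G (s - of_int (int_decode i))) has_sum C) UNIV"
      using sum[of s] by (subst has_sum_reindex_bij_betw[OF bij_int_decode]) auto
    then show ?thesis
      using True by (auto simp: g_def dest!: has_sum_imp_sums sums_unique)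
  qed (simp add: g_def)
  have g_summable: "summable (\<lambda>i. norm (g i s))" for s
    by (rule summable_comparison_test'[OF summable_mult[OF M_dec, of "indicator {0..<1} s"]])
      (use g_le in simp)
  have "(\<lambda>i. integral\<^sup>L lborel (g i)) sums (LBINT s. \<Sum>i. g i s)"
    by (rule sums_integral) (simp_all add: int_g g_summable summable_int)
  then have "(\<lambda>i. integral\<^sup>L lborel (g i)) sums C"
    by (simp add: g_sum)
  with sums_G have int_eq: "integral\<^sup>L lborel G = C"
    by (rule sums_unique2)
  show "integral UNIV G = C"
    using has_integral_integral_lborel[OF int_G] int_eq by (simp add: integral_unique)
  \<comment> \<open>Absolute integrability refers to the completed measure, so Borel integrability
    has to be transferred.\<close>
  show "G absolutely_integrable_on UNIV"
    using int_G borel_measurable_integrable[OF int_G]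
    by (simp add: set_integrable_def integrable_completion)
qed

subsection \<open>The bilateral sum and the integral\<close>

text \<open>The coefficients in the product of Euler's series for (\<beta> w; p) and (\<alpha> / w;
  p); the index pair (k, l) belongs to the power w^(k-l).\<close>

definition pair_coeff :: "complex \<Rightarrow> complex \<Rightarrow> complex \<Rightarrow> nat \<times> nat \<Rightarrow> complex"
  where "pair_coeff p \<beta> \<alpha> = (\<lambda>(k, l). euler_A p k * \<beta> ^ k * (euler_A p l * \<alpha> ^ l))"

lemma pair_coeff_has_sum:
  assumes "norm p < 1" "w \<noteq> 0"
  shows "((\<lambda>x. pair_coeff p \<beta> \<alpha> x * w powi (int (fst x) - int (snd x)))
      has_sum qpoch (\<beta> * w) p * qpoch (\<alpha> / w) p) UNIV"
proof -
  have "((\<lambda>(k, l). euler_A p k * (\<beta> * w) ^ k * (euler_A p l * (\<alpha> / w) ^ l))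
      has_sum qpoch (\<beta> * w) p * qpoch (\<alpha> / w) p) (UNIV \<times> UNIV)"
    by (intro has_sum_product euler_A_abs_summable euler_A_has_sum assms)
  moreover have "euler_A p k * (\<beta> * w) ^ k * (euler_A p l * (\<alpha> / w) ^ l)
      = pair_coeff p \<beta> \<alpha> (k, l) * w powi (int k - int l)" for k l
    using assms by (simp add: pair_coeff_def power_int_diff power_mult_distrib power_divide)
  ultimately show ?thesis
    by (simp add: case_prod_unfold)
qed

text \<open>Expanding \<open>gauss\<close> at \<open>k - l\<close> splits the term into one factor
  in \<open>k\<close>, one in \<open>l\<close> and \<open>q ^ (k * l)\<close>, which has modulus at
  most 1. The \<open>\<alpha> / q\<close> comes from the reflection of \<open>l\<close>.\<close>

lemma pair_coeff_abs_summable: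
  assumes pq: "norm p < norm q" and q: "norm q < 1"
  shows "(\<lambda>x. norm (pair_coeff p \<beta> \<alpha> x / gauss q (int (fst x) - int (snd x)))) summable_on UNIV"
proof (rule Infinite_Sum.abs_summable_on_comparison_test')
  have q0: "q \<noteq> 0" using pq by auto
  have A: "(\<lambda>k. norm (euler_A p k / gauss q (int k) * x ^ k)) summable_on UNIV" for x
    using summable_euler_A_div_gauss[OF assms] by (simp add: summable_on_UNIV_nonneg_real_iff)
  show "(\<lambda>(k, l). norm (euler_A p k / gauss q (int k) * \<beta> ^ k *
      (euler_A p l / gauss q (int l) * (\<alpha> / q) ^ l))) summable_on UNIV"
    using abs_summable_on_product[OF A A] by simp
  fix x :: "nat \<times> nat"
  obtain k l where x: "x = (k, l)" by force
  have "gauss q (int k - int l) = gauss q (int k) * (gauss q (int l) * q ^ l) / q ^ (k * l)"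
    using gauss_add[OF q0, of "int k" "- int l"] gauss_plus_1[OF q0, of "int l"] q0
    by (simp add: gauss_uminus power_int_minus divide_inverse flip: of_nat_mult)
  then have "pair_coeff p \<beta> \<alpha> x / gauss q (int k - int l) = euler_A p k / gauss q (int k) * \<beta> ^ k *
      (euler_A p l / gauss q (int l) * (\<alpha> / q) ^ l) * q ^ (k * l)"
    using q0 by (simp add: x pair_coeff_def power_divide field_simps)
  moreover have "norm (q ^ (k * l)) \<le> 1"
    using q by (simp add: norm_power power_le_one)
  ultimately show "norm (pair_coeff p \<beta> \<alpha> x / gauss q (int (fst x) - int (snd x)))
      \<le> (case x of (k, l) \<Rightarrow> norm (euler_A p k / gauss q (int k) * \<beta> ^ k *
      (euler_A p l / gauss q (int l) * (\<alpha> / q) ^ l)))"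
    unfolding x by (simp only: fst_conv snd_conv prod.case norm_mult mult_left_le norm_ge_zero
        mult_nonneg_nonneg)
qed

text \<open>A unit step of the parameter is one multiplicative period of theta, because
  \<open>q = exp (- Ln (1 / q))\<close>.\<close>

lemma qpath_shift:
  assumes "q \<noteq> 0"
  shows "qpath q (s - of_int n) = q powi n * qpath q s"
proof -
  have "q = exp (- Ln (1 / q))"
    using assms by (simp add: exp_minus)
  then have "q powi n = exp (of_int n * - Ln (1 / q))"
    by (metis exp_power_int)
  then show ?thesis
    by (simp add: qpath_def algebra_simps flip: exp_add)
qed

lemma Re_Ln_inverse_pos:
  assumes "q \<noteq> 0" "norm q < 1"
  shows "Re (Ln (1 / q)) > 0"
  using assms by (simp add: Re_Ln norm_divide)

lemma norm_qpath: "norm (qpath q s) = exp (s * Re (Ln (1 / q)))"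
  by (simp add: qpath_def)

text \<open>A zero has the form \<open>t = - (q powi j)\<close>, so a shift by a period would place
  \<open>- 1\<close> on the path. The path has modulus 1 only at parameter 0, where its value is
  1.\<close>

lemma qtheta_qpath_nonzero:
  assumes q: "q \<noteq> 0" "norm q < 1"
  shows "qtheta q (qpath q s) \<noteq> 0"
proof
  have shift: "qpath q (s - of_int j) \<noteq> - 1" for j
  proof
    assume *: "qpath q (s - of_int j) = - 1"
    then have "exp ((s - of_int j) * Re (Ln (1 / q))) = 1"
      using norm_qpath[of q "s - of_int j"] by simp
    then have "s - of_int j = 0"
      using Re_Ln_inverse_pos[OF q] by simp
    with * show False by (simp add: qpath_def)
  qed
  have t0: "qpath q s \<noteq> 0" by (simp add: qpath_def)
  assume "qtheta q (qpath q s) = 0"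
  then consider k where "- qpath q s * q ^ k = 1" | k where "- q / qpath q s * q ^ k = 1"
    using qpoch_eq_0_iff[OF q(2)] by (auto simp: qtheta_def)
  then show False
  proof cases
    case (1 k)
    then have "q powi int k * qpath q s = - 1"
      by (simp add: mult.commute minus_equation_iff)
    then show False using shift[of "int k"] qpath_shift[OF q(1)] by metis
  next
    case (2 k)
    then have "- (q ^ Suc k) = qpath q s"
      using t0 by (simp add: field_simps)
    then have "qpath q s = - (q ^ Suc k)"
      by (rule sym)
    then have "q powi (- int (Suc k)) * qpath q s = - 1"
      using q by (simp add: power_int_minus del: of_nat_Suc power_Suc)
    then show False using shift qpath_shift[OF q(1)] by metis
  qed
qed

lemma continuous_on_qpath [continuous_intros]: "continuous_on S (qpath q)"
  unfolding qpath_def by (intro continuous_intros)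

text \<open>Integrability is part of the conclusion because \<open>integral\<close> takes a default
  value on functions that are not integrable. The use of \<open>has_sum\<close> makes the
  convergence of the bilateral series unconditional.\<close>

theorem theorem2:
  fixes a b p q z :: complex
  assumes "norm p < norm q" and "norm q < 1" and "z \<noteq> 0"
  shows "qpath_integrable q (\<lambda>t. qpoch (b * t / z) p * qpoch (a * z / t) p
                    / (qpoch (- t) q * qpoch (- q / t) q) / t) \<and>
    ((\<lambda>n::int. qpoch (b * q powi n) p * qpoch (a * q powi (- n)) p
                 * z powi n * q powi (n * (n - 1) div 2))
      has_sum (qpoch (- z) q * qpoch (- q / z) q / Ln (1 / q)
               * qpath_integral q (\<lambda>t. qpoch (b * t / z) p * qpoch (a * z / t) p
                    / (qpoch (- t) q * qpoch (- q / t) q) / t))) UNIV"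
proof -
  have q: "q \<noteq> 0" "norm q < 1" and p: "norm p < 1" using assms by auto
  define L where "L = Ln (1 / q)"
  have L0: "L \<noteq> 0" using Re_Ln_inverse_pos[OF q] by (auto simp: L_def)
  define m :: "nat \<times> nat \<Rightarrow> int" where "m = (\<lambda>x. int (fst x) - int (snd x))"
  \<comment> \<open>With these parameters the value of \<open>W\<close> at
    \<open>q powi n * z\<close> is the product of the two \<open>qpoch\<close> factors in the
    \<open>n\<close>-th term of the stated sum.\<close>
  define c where "c = pair_coeff p (b / z) (a * z)"
  define W where "W = (\<lambda>t. qpoch (b / z * t) p * qpoch (a * z / t) p)"
  have W: "((\<lambda>x. c x * w powi m x) has_sum W w) UNIV" if "w \<noteq> 0" for w
    unfolding W_def c_def m_def by (rule pair_coeff_has_sum[OF p that])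
  have c: "(\<lambda>x. norm (c x / gauss q (m x))) summable_on UNIV"
    unfolding c_def m_def by (rule pair_coeff_abs_summable[OF assms(1,2)])
  obtain C where C: "((\<lambda>x. c x / gauss q (m x)) has_sum C) UNIV"
    using abs_summable_summable[OF c] by (auto simp: summable_on_def)
  \<comment> \<open>The constant of proportionality between sum and theta: \<open>C\<close> comes
    from the index shift, \<open>qpoch q q\<close> from the triple product, and neither involves
    \<open>t\<close>.\<close>
  define D where "D = C * qpoch q q"
  have W_sum: "((\<lambda>n. W (q powi n * t) * (t powi n * gauss q n)) has_sum D * qtheta q t) UNIV"
    if "t \<noteq> 0" for t
    using has_sum_gauss_shift[OF q that c C, of "\<lambda>n. W (q powi n * t)"] W that q
    by (simp add: jacobi_triple_product D_def mult.assoc)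
  define G where "G = qpath_integrand q (\<lambda>t. qpoch (b * t / z) p * qpoch (a * z / t) p
                    / (qpoch (- t) q * qpoch (- q / t) q) / t)"
  have path0: "qpath q s \<noteq> 0" for s by (simp add: qpath_def)
  \<comment> \<open>The derivative of the path is \<open>L\<close> times the path itself, which
    cancels the division by \<open>t\<close>.\<close>
  have G: "G s = L * (W (qpath q s) / qtheta q (qpath q s))" for s
    using path0 by (simp add: G_def qpath_integrand_def L_def W_def qtheta_def
        vector_derivative_at[OF qpath_has_vector_derivative])
  have qpoch_q: "qpoch q q \<noteq> 0"
    using qpoch_eq_0_iff[OF q(2), of q] power_Suc_neq_1[OF q(2)] by auto
  \<comment> \<open>The quasi-periodicity of \<open>jtheta\<close> passes to \<open>qtheta\<close>
    after cancelling \<open>qpoch q q\<close>, and turns translates of the integrand into terms of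
    the sum at the point \<open>qpath q s\<close>.\<close>
  have G_shift: "G (s - of_int n) = L / qtheta q (qpath q s) *
      (W (q powi n * qpath q s) * (qpath q s powi n * gauss q n))" for s n
  proof -
    have "qtheta q (qpath q (s - of_int n)) * (qpath q s powi n * gauss q n) = qtheta q (qpath q s)"
      using jtheta_quasiperiodic[OF q path0[of s], of n] q path0 qpoch_q
      by (simp add: jacobi_triple_product qpath_shift)
    then show ?thesis
      unfolding G qpath_shift[OF q(1)]
      using qtheta_qpath_nonzero[OF q, of "s - of_int n"] qtheta_qpath_nonzero[OF q, of s]
      by (simp add: qpath_shift[OF q(1)] field_simps)
  qed
  have cont_theta: "continuous_on UNIV (\<lambda>s. qtheta q (qpath q s))"
    unfolding qtheta_def by (intro continuous_intros continuous_on_qpoch q) (auto simp: path0)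
  have cont_G: "continuous_on UNIV G"
    unfolding G W_def
    by (intro continuous_intros continuous_on_qpoch p cont_theta)
      (auto simp: path0 qtheta_qpath_nonzero[OF q])
  \<comment> \<open>For \<open>0 \<le> s \<le> 1\<close> the path stays in the annulus between radii
    1 and \<open>R\<close>.\<close>
  define R where "R = exp (Re L)"
  have ReL: "Re L > 0" using Re_Ln_inverse_pos[OF q] by (simp add: L_def)
  obtain M where M: "M summable_on UNIV"
    and bound: "\<And>n t S. 1 \<le> norm t \<Longrightarrow> norm t \<le> R \<Longrightarrow>
      ((\<lambda>x. c x * (q powi n * t) powi m x) has_sum S) UNIV \<Longrightarrow>
      norm (S * (t powi n * gauss q n)) \<le> M n"
    using gauss_shift_uniform_bound[OF q _ c, of R] ReL by (auto simp: R_def)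
  \<comment> \<open>The theta denominator is continuous and free of zeros on a compact period, so
    its reciprocal is bounded there.\<close>
  have "continuous_on {0..1} (\<lambda>s. L / qtheta q (qpath q s))"
    by (intro continuous_intros continuous_on_subset[OF cont_theta])
      (auto simp: qtheta_qpath_nonzero[OF q])
  then have "bounded ((\<lambda>s. L / qtheta q (qpath q s)) ` {0..1})"
    by (intro compact_imp_bounded compact_continuous_image) auto
  then obtain B where "\<forall>s\<in>{0..1}. norm (L / qtheta q (qpath q s)) \<le> B"
    unfolding bounded_iff by blast
  then have B: "norm (L / qtheta q (qpath q s)) \<le> B" if "0 \<le> s" "s \<le> 1" for s
    using that by simp
  have fold: "G absolutely_integrable_on UNIV" "integral UNIV G = L * D"
  \<comment> \<open>The rule is applied to both goals, so each of its premises is established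
    twice.\<close>
  proof (rule_tac [!] integral_fold_unit_interval[OF cont_G])
    show "(\<lambda>n. B * M n) summable_on UNIV" "(\<lambda>n. B * M n) summable_on UNIV"
      by (intro summable_on_cmult_right M)+
    show "norm (G (s - of_int n)) \<le> B * M n" if s: "0 \<le> s" "s \<le> 1" for s n
    proof -
      have "1 \<le> norm (qpath q s)" "norm (qpath q s) \<le> R"
        using s ReL mult_right_mono[of s 1 "Re L"] by (auto simp: norm_qpath R_def simp flip: L_def)
      then have "norm (W (q powi n * qpath q s) * (qpath q s powi n * gauss q n)) \<le> M n"
        using q path0 by (intro bound W) auto
      moreover have "B \<ge> 0"
        using B[OF s] norm_ge_zero order_trans by blast
      ultimately show ?thesis
        unfolding G_shift norm_mult[of "L / _"] using B[OF s] by (intro mult_mono) auto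
    qed
    then show "norm (G (s - of_int n)) \<le> B * M n" if "0 \<le> s" "s \<le> 1" for s n
      using that .
    \<comment> \<open>The theta value from \<open>W_sum\<close> cancels the denominator, so the
      folded sum is independent of \<open>s\<close>.\<close>
    show "((\<lambda>n. G (s - of_int n)) has_sum L * D) UNIV" for s
      using has_sum_cmult_right[OF W_sum[OF path0, of s], of "L / qtheta q (qpath q s)"]
      unfolding G_shift by (simp add: qtheta_qpath_nonzero[OF q])
    then show "((\<lambda>n. G (s - of_int n)) has_sum L * D) UNIV" for s .
  qed
  have term_eq: "W (q powi n * z) * (z powi n * gauss q n) = qpoch (b * q powi n) p * qpoch (a * q powi (- n)) p
                 * z powi n * q powi (n * (n - 1) div 2)" for n
    using assms(3) by (simp add: W_def gauss_def power_int_minus field_simps)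
  have value_eq: "D * qtheta q z = qpoch (- z) q * qpoch (- q / z) q / L * (L * D)"
    using L0 by (simp add: qtheta_def)
  have "((\<lambda>n::int. qpoch (b * q powi n) p * qpoch (a * q powi (- n)) p
                 * z powi n * q powi (n * (n - 1) div 2))
      has_sum (qpoch (- z) q * qpoch (- q / z) q / L * (L * D))) UNIV"
    using W_sum[OF assms(3)] unfolding term_eq value_eq .
  then show ?thesis
    using fold unfolding qpath_integrable_def qpath_integral_def L_def G_def by auto
qed

end
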